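(* Let $X$ be a real topological vector space and let $A\subseteq X$ be a convex subset which is convex normal. Let $A_0$ be a nonempty closed (in $A$) convex subset of $A$, and let $B\subseteq A$ be an open (in $A$) convex subset of $A$ with $A_0\subseteq B$. Then there is a continuous quasi convex function $f:A\to[0,1]$ such that $f(y)=0$ for every $y\in A_0$ and $f(y)=1$ for every $y\in A\setminus B$.
   Context: Subsets $A$ of a topological vector space carry the subspace topology; open, closed and the closure $cl$ are taken in $A$. A subset $A$ of a topological vector space is said to be locally convex if every point of $A$ has a local base in $A$ consisting of convex subsets of $A$. A locally convex subset $A$ of a topological vector space is said to be convex normal if for every nonempty closed subset $A_0$ of $A$ and every open (in $A$) convex set $B\subseteq A$ with $A_0\subseteq B$, there is an open (in $A$) convex subset $C$ of $A$ such that $A_0\subseteq C\subseteq cl\,C\subseteq B$. A function $f:A\to\mathbb{R}$ on a convex subset $A$ of a real vector space is quasi convex if $\{x\in A: f(x)<r\}$ (equivalently, $\{x\in A: f(x)\le r\}$) is a convex set for every real number $r$. *)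

theory Defs
  imports "HOL-Analysis.Analysis"
begin

(* No separation axiom is imposed. *)
class real_topological_vector = topological_ab_group_add + real_vector +
  assumes tendsto_scaleR_Pair:
    "LIM x (nhds a \<times>\<^sub>F nhds b). fst x *\<^sub>R snd x :> nhds (a *\<^sub>R b)"

instance real_normed_vector < real_topological_vector
proof
  fix a :: real and b :: 'a
  show "LIM x (nhds a \<times>\<^sub>F nhds b). fst x *\<^sub>R snd x :> nhds (a *\<^sub>R b)"
    by (intro tendsto_scaleR filterlim_fst filterlim_snd)
qed

(* The library predicate "locally convex A" expresses local convexity of A through convex
   neighbourhoods in A that need not be open; this is implied by having a base of open convex
   sets at every point. *)
definition convex_normal :: "'a::real_topological_vector set \<Rightarrow> bool" where
  "convex_normal A \<longleftrightarrow>
     locally convex A \<and>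
     (\<forall>A0 B. A0 \<noteq> {} \<and> closedin (top_of_set A) A0 \<and>
             openin (top_of_set A) B \<and> convex B \<and> A0 \<subseteq> B \<longrightarrow>
        (\<exists>C. openin (top_of_set A) C \<and> convex C \<and>
             A0 \<subseteq> C \<and> C \<subseteq> (top_of_set A) closure_of C \<and>
             (top_of_set A) closure_of C \<subseteq> B))"

definition quasi_convex_on :: "'a::real_vector set \<Rightarrow> ('a \<Rightarrow> real) \<Rightarrow> bool" where
  "quasi_convex_on A f \<longleftrightarrow> convex A \<and> (\<forall>r. convex {x \<in> A. f x < r})"

end

theory Submission
  imports Defs
begin

text \<open>
  This is Urysohn's construction, carried out inside the family of open convex subsets of \<open>A\<close>.
  Write \<open>C \<lless> D\<close> when \<open>C\<close> and \<open>D\<close> are nonempty, open and convex in \<open>A\<close> and the closure of \<open>C\<close>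
  lies in \<open>D\<close>. Convex normality, applied to the closed set \<open>cl C\<close>, interpolates: from \<open>C \<lless> D\<close> one
  obtains \<open>E\<close> with \<open>C \<lless> E \<lless> D\<close>. Applied to \<open>A0\<close> itself, it gives a first set \<open>C\<close> with
  \<open>A0 \<subseteq> C \<lless> B\<close>. Hence \<open>C\<close> and \<open>B\<close> are joined by a chain \<open>G r\<close>, indexed by the dyadic rationals
  \<open>r\<close> in \<open>{0..1}\<close>, with \<open>G r \<lless> G s\<close> whenever \<open>r < s\<close>.

  The function sending \<open>x\<close> to the infimum of the indices \<open>r\<close> with \<open>x \<in> G r\<close> (and to \<open>1\<close> if there
  are none) is continuous (\<open>Urysohn_function_of_dyadic_chain\<close>): its strict sublevel sets are unions
  of sets \<open>G s\<close>, and its strict superlevel sets are unions of complements of closures of sets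
  \<open>G s\<close>. It vanishes on \<open>G 0 = C\<close> and equals \<open>1\<close> off \<open>G 1 = B\<close>. It is quasi
  convex because each strict sublevel set is either all of \<open>A\<close> or the union of the convex sets
  \<open>G s\<close> with \<open>s < r\<close>, which form a chain (\<open>convex_Union_chain\<close>).
\<close>

lemma convex_Union_chain:
  assumes "\<And>S. S \<in> \<C> \<Longrightarrow> convex S"
    and "\<And>S T. S \<in> \<C> \<Longrightarrow> T \<in> \<C> \<Longrightarrow> S \<subseteq> T \<or> T \<subseteq> S"
  shows "convex (\<Union>\<C>)"
proof (rule convexI)
  fix x y and u v :: real
  assume xy: "x \<in> \<Union>\<C>" "y \<in> \<Union>\<C>" and uv: "0 \<le> u" "0 \<le> v" "u + v = 1"
  then obtain S where "S \<in> \<C>" "x \<in> S" "y \<in> S"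
    using assms(2) by blast
  then show "u *\<^sub>R x + v *\<^sub>R y \<in> \<Union>\<C>"
    using assms(1) uv convexD by blast
qed

lemma dyadic_between:
  fixes a b :: real
  assumes "0 \<le> a" "a < b" "b \<le> 1"
  obtains r where "r \<in> dyadics \<inter> {0..1}" "a < r" "r < b"
proof -
  obtain n q m where *: "real q / 2^n \<le> a" "a < real m / 2^n" "\<bar>real q / 2^n - real m / 2^n\<bar> < b - a"
  proof (rule padic_rational_approximation_straddle_pos_le[of "b - a" 2 a])
    show "0 < b - a" "1 < (2::real)" "0 \<le> a"
      using assms by auto
  qed
  show thesis
  proof
    show "a < real m / 2^n" "real m / 2^n < b"
      using * by linarith+
    then have "real m / 2^n \<in> {0..1}"
      using assms unfolding atLeastAtMost_iff by linarith
    then show "real m / 2^n \<in> dyadics \<inter> {0..1}"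
      unfolding dyadics_def by blast
  qed
qed

text \<open>
  The analytic half of Urysohn's lemma, for an arbitrary chain of open sets. The strict sublevel
  sets are described explicitly so that properties of the chain can be transferred to \<open>f\<close>.
\<close>

lemma Urysohn_function_of_dyadic_chain:
  fixes G :: "real \<Rightarrow> 'a set"
  defines "D \<equiv> dyadics \<inter> {0..1::real}"
  assumes opeG: "\<And>r. r \<in> D \<Longrightarrow> openin X (G r)"
    and cloG: "\<And>r s. r \<in> D \<Longrightarrow> s \<in> D \<Longrightarrow> r < s \<Longrightarrow> X closure_of G r \<subseteq> G s"
  obtains f where "continuous_map X euclideanreal f" "f \<in> topspace X \<rightarrow> {0..1}"
    "\<And>x. x \<in> G 0 \<Longrightarrow> f x = 0" "\<And>x. x \<in> topspace X - G 1 \<Longrightarrow> f x = 1"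
    "\<And>a x. f x < a \<longleftrightarrow> 1 < a \<or> (\<exists>r\<in>D. r < a \<and> x \<in> G r)"
proof -
  define f where "f x = Inf (insert 1 {r \<in> D. x \<in> G r})" for x
  have bdd: "bdd_below (insert 1 {r \<in> D. x \<in> G r})" for x
    by (rule bdd_belowI[of _ 0]) (auto simp: D_def)
  have less_iff: "f x < a \<longleftrightarrow> 1 < a \<or> (\<exists>r\<in>D. r < a \<and> x \<in> G r)" for x a
    unfolding f_def by (subst cInf_less_iff[OF _ bdd]) auto
  have D01: "0 \<in> D" "1 \<in> D"
    using real_in_dyadics[of 0] real_in_dyadics[of 1] by (auto simp: D_def)
  have f0: "0 \<le> f x" for x
    using less_iff[of x 0] by (auto simp: D_def)
  have f1: "f x \<le> 1" for x
    unfolding f_def by (rule cInf_lower[OF _ bdd]) auto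
  have fle: "f x \<le> r" if "r \<in> D" "x \<in> G r" for x r
    unfolding f_def by (rule cInf_lower[OF _ bdd]) (use that in auto)
  have subG: "G r \<subseteq> X closure_of G r" if "r \<in> D" for r
    using opeG[OF that] by (simp add: closure_of_subset openin_subset)
  have fge: "s \<le> f x" if "s \<in> D" "x \<notin> G s" for x s
  proof (rule ccontr)
    assume "\<not> s \<le> f x"
    moreover have "s \<le> 1"
      using that(1) by (simp add: D_def)
    ultimately obtain r where "r \<in> D" "r < s" "x \<in> G r"
      using less_iff[of x s] by auto
    then show False
      using subG cloG that by blast
  qed
  \<comment> \<open>Two dyadics are inserted between \<open>a\<close> and \<open>f x\<close>: the larger index \<open>t\<close> only excludes \<open>x\<close> from
    \<open>G t\<close>, and the smaller one then excludes it from a closure, whose complement is open.\<close>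
  have greater_iff: "a < f x \<longleftrightarrow> (\<exists>s\<in>D. a < s \<and> x \<notin> X closure_of G s)" if "0 \<le> a" for a x
  proof
    assume "a < f x"
    then obtain t where t: "t \<in> D" "a < t" "t < f x"
      using dyadic_between[of a "f x"] f1 \<open>0 \<le> a\<close> unfolding D_def by blast
    then obtain s where s: "s \<in> D" "a < s" "s < t"
      using dyadic_between[of a t] \<open>0 \<le> a\<close> unfolding D_def by auto
    have "x \<notin> G t"
      using fle t by force
    then show "\<exists>s\<in>D. a < s \<and> x \<notin> X closure_of G s"
      using cloG s t by blast
  next
    assume "\<exists>s\<in>D. a < s \<and> x \<notin> X closure_of G s"
    then show "a < f x"
      using subG fge by force
  qed
  have "openin X {x \<in> topspace X. a < f x}" for a
  proof (cases "0 \<le> a")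
    case True
    have "{x \<in> topspace X. a < f x} = (\<Union>s\<in>{s\<in>D. a < s}. topspace X - X closure_of G s)"
      using greater_iff[OF True] by auto
    moreover have "openin X \<dots>"
      by (intro openin_Union) auto
    ultimately show ?thesis
      by simp
  next
    case False
    then have "a < f x" for x
      using f0[of x] by linarith
    then show ?thesis
      by simp
  qed
  moreover have "openin X {x \<in> topspace X. f x < a}" for a
  proof (cases "1 < a")
    case True
    then show ?thesis
      by (simp add: less_iff)
  next
    case False
    moreover have "G r \<subseteq> topspace X" if "r \<in> D" for r
      using opeG[OF that] by (rule openin_subset)
    ultimately have "{x \<in> topspace X. f x < a} = (\<Union>r\<in>{r\<in>D. r < a}. G r)"
      using less_iff by auto
    moreover have "openin X \<dots>"
      using opeG by (intro openin_Union) auto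
    ultimately show ?thesis
      by simp
  qed
  ultimately have "continuous_map X euclideanreal f"
    by (simp add: continuous_map_upper_lower_semicontinuous_lt)
  moreover have "f x = 0" if "x \<in> G 0" for x
    using fle[OF D01(1) that] f0[of x] by simp
  moreover have "f x = 1" if "x \<in> topspace X - G 1" for x
    using fge[OF D01(2), of x] f1[of x] that by simp
  ultimately show thesis
    using that less_iff f0 f1 by (simp add: Pi_iff)
qed

theorem mainTheorem1:
  fixes A A0 B :: "'a::real_topological_vector set"
  assumes "convex A" and "convex_normal A"
    and "A0 \<noteq> {}" and "closedin (top_of_set A) A0" and "convex A0"
    and "openin (top_of_set A) B" and "convex B" and "A0 \<subseteq> B"
  shows "\<exists>f :: 'a \<Rightarrow> real. f ` A \<subseteq> {0..1} \<and> continuous_on A f \<and> quasi_convex_on A f \<and>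
           (\<forall>y\<in>A0. f y = 0) \<and> (\<forall>y\<in>A - B. f y = 1)"
proof -
  let ?X = "top_of_set A"
  let ?D = "dyadics \<inter> {0..1::real}"
  define good where "good C \<longleftrightarrow> openin ?X C \<and> convex C \<and> C \<noteq> {}" for C
  define R where "R C D \<longleftrightarrow> good C \<and> good D \<and> ?X closure_of C \<subseteq> D" for C D
  have clo: "C \<subseteq> ?X closure_of C" if "good C" for C
    by (rule closure_of_subset[OF openin_subset]) (use that good_def in simp)
  have interp: "\<exists>C. good C \<and> S \<subseteq> C \<and> ?X closure_of C \<subseteq> U"
    if S: "S \<noteq> {}" "closedin ?X S" "S \<subseteq> U" and "good U" for S U
  proof -
    obtain C where "openin ?X C" "convex C" "S \<subseteq> C" "?X closure_of C \<subseteq> U"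
      using \<open>convex_normal A\<close> \<open>good U\<close> S unfolding convex_normal_def good_def by meson
    then show ?thesis
      using \<open>S \<noteq> {}\<close> unfolding good_def by blast
  qed
  have "good B"
    using assms unfolding good_def by blast
  with assms obtain C where C: "good C" "A0 \<subseteq> C" "?X closure_of C \<subseteq> B"
    using interp[of A0 B] by blast
  have "\<exists>G :: real \<Rightarrow> 'a set. G 0 = C \<and> G 1 = B \<and> (\<forall>r\<in>?D. \<forall>s\<in>?D. r < s \<longrightarrow> R (G r) (G s))"
  proof (rule recursion_on_dyadic_fractions)
    show "R C B"
      using C \<open>good B\<close> unfolding R_def by blast
    show "\<exists>E. R S E \<and> R E T" if "R S T" for S T
    proof -
      have "?X closure_of S \<noteq> {}"
        using that clo[of S] unfolding R_def good_def by blast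
      then show ?thesis
        using that interp[of "?X closure_of S" T] unfolding R_def by auto
    qed
    show "R S U" if "R S T" "R T U" for S T U
      using that clo[of T] unfolding R_def by blast
  qed
  then obtain G :: "real \<Rightarrow> 'a set" where G: "G 0 = C" "G 1 = B"
    and RG: "\<And>r s. r \<in> ?D \<Longrightarrow> s \<in> ?D \<Longrightarrow> r < s \<Longrightarrow> R (G r) (G s)"
    by blast
  have D1: "1 \<in> ?D"
    using real_in_dyadics[of 1] by simp
  have goodG: "good (G r)" if "r \<in> ?D" for r
  proof (cases "r = 1")
    case False
    then show ?thesis
      using RG[OF that D1] that unfolding R_def by simp
  qed (simp add: G \<open>good B\<close>)
  have cloG: "?X closure_of G r \<subseteq> G s" if "r \<in> ?D" "s \<in> ?D" "r < s" for r s
    using RG[OF that] unfolding R_def by blast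
  obtain f where f: "continuous_map ?X euclideanreal f" "f \<in> topspace ?X \<rightarrow> {0..1}"
      "\<And>x. x \<in> G 0 \<Longrightarrow> f x = 0" "\<And>x. x \<in> topspace ?X - G 1 \<Longrightarrow> f x = 1"
      "\<And>a x. f x < a \<longleftrightarrow> 1 < a \<or> (\<exists>r\<in>?D. r < a \<and> x \<in> G r)"
  proof (rule Urysohn_function_of_dyadic_chain[of ?X G])
    show "openin ?X (G r)" if "r \<in> ?D" for r
      using goodG[OF that] unfolding good_def by blast
  qed (use cloG in blast)+
  have "convex {x \<in> A. f x < a}" for a
  proof (cases "1 < a")
    case True
    then show ?thesis
      using \<open>convex A\<close> by (simp add: f(5))
  next
    case False
    have "G r \<subseteq> A" if "r \<in> ?D" for r
      using goodG[OF that] openin_subset unfolding good_def by fastforce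
    then have "{x \<in> A. f x < a} = \<Union> (G ` {r \<in> ?D. r < a})"
      using False f(5) by blast
    moreover have "convex \<dots>"
    proof (rule convex_Union_chain)
      have mono: "G r \<subseteq> G s" if "r \<in> ?D" "s \<in> ?D" "r \<le> s" for r s
        using cloG[OF that(1,2)] clo[OF goodG[OF that(1)]] that(3) by fastforce
      fix S T assume "S \<in> G ` {r \<in> ?D. r < a}" "T \<in> G ` {r \<in> ?D. r < a}"
      then obtain r s where "r \<in> ?D" "S = G r" "s \<in> ?D" "T = G s"
        by blast
      then show "S \<subseteq> T \<or> T \<subseteq> S"
        using mono[of r s] mono[of s r] linear[of r s] by blast
    qed (use goodG good_def in auto)
    ultimately show ?thesis
      by simp
  qed
  then have "quasi_convex_on A f"
    using \<open>convex A\<close> unfolding quasi_convex_on_def by blast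
  moreover have "f ` A \<subseteq> {0..1}" "continuous_on A f"
    using f(1,2) by auto
  moreover have "\<forall>y\<in>A0. f y = 0" "\<forall>y\<in>A - B. f y = 1"
    using f(3,4) G C(2) by auto
  ultimately show ?thesis
    by blast
qed

end
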